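(* Let $X$ and $Y$ be independent real-valued centered Gaussian random variables, each with positive variance. Then for all $n,m,r\in\mathbb{N}$, $$\mathbf{E}\left[X^{2m}Y^{2n}(X+Y)^{2r}\right]\geq \binom{(m\wedge n)+r}{r}_{\frac12}\,\mathbf{E}[X^{2m}]\,\mathbf{E}[Y^{2n}]\,\mathbf{E}[(X+Y)^{2r}].$$
   Context: $\mathbb{N}=\{1,2,3,\dots\}$, $m\wedge n=\min\{m,n\}$, and $\mathbf{E}$ denotes expectation. For real $\alpha\neq 0$, $(\alpha)_0=1$ and $(\alpha)_k=\alpha(\alpha+1)\cdots(\alpha+k-1)$ for $k\geq 1$. For integers $0\le k\le n$, $$\binom{n}{k}_{\frac12}:=\frac{\left(\frac12\right)_n}{\left(\frac12\right)_{n-k}\left(\frac12\right)_k}=\frac{(2n-1)!!}{(2n-2k-1)!!\,(2k-1)!!},$$ with the convention $(-1)!!=1$. *)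

theory Defs
  imports "HOL-Probability.Probability"
begin

(* Only meaningful for k <= n, since the subtraction on nat truncates. *)
definition half_binomial :: "nat \<Rightarrow> nat \<Rightarrow> real" where
  "half_binomial n k = pochhammer (1/2) n / (pochhammer (1/2) (n - k) * pochhammer (1/2) k)"

end

theory Submission
  imports Defs
begin

text \<open>
  Expanding \<open>(X + Y) ^ (2 * r)\<close> binomially on both sides reduces the claim to a comparison of
  corresponding terms. Terms with odd powers vanish. For the even ones,
  \<open>E[X^(2*(m+j))] = half_binomial (m + j) j * E[X^(2*m)] * E[X^(2*j)]\<close>, so all that is needed is
  \<open>half_binomial (k + i + j) (i + j) \<le> half_binomial (m + i) i * half_binomial (n + j) j\<close>
  for \<open>k = min m n\<close>. This follows from the product formula for \<open>half_binomial (m + j) j\<close>, whose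
  factors are affine in \<open>j\<close>, and from \<open>1 + (x + y) \<le> (1 + x) * (1 + y)\<close>.
\<close>

text \<open>Cutting \<open>pochhammer (1/2) (m + j)\<close> after its first \<open>j\<close> factors
  cancels \<open>pochhammer (1/2) j\<close>. In the resulting product \<open>m\<close> only counts
  factors and \<open>j\<close> only enters each of them linearly, so the dependence on either can be
  studied factor by factor.\<close>

lemma half_binomial_add_eq_prod:
  "half_binomial (m + j) j = (\<Prod>i<m. 1 + real j / (1/2 + real i))"
proof -
  have pos: "pochhammer (1/2::real) k > 0" for k
    by (simp add: pochhammer_pos)
  have "half_binomial (m + j) j = pochhammer (1/2 + real j) m / pochhammer (1/2) m"
    using pos[of j] pochhammer_product'[of "1/2::real" j m]
    by (simp add: half_binomial_def add.commute)
  also have "\<dots> = (\<Prod>i<m. (1/2 + real j + real i) / (1/2 + real i))"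
    by (simp add: pochhammer_prod prod_dividef atLeast0LessThan)
  also have "\<dots> = (\<Prod>i<m. 1 + real j / (1/2 + real i))"
  proof (rule prod.cong)
    fix i
    have "1/2 + real i > 0" by simp
    then show "(1/2 + real j + real i) / (1/2 + real i) = 1 + real j / (1/2 + real i)"
      by (simp add: field_simps)
  qed simp
  finally show ?thesis .
qed

lemma half_binomial_add_pos: "0 < half_binomial (m + j) j"
  by (simp add: half_binomial_def pochhammer_pos)

text \<open>Every factor of the product formula is at least 1, so additional factors cannot decrease
  it.\<close>

lemma half_binomial_add_mono:
  assumes "k \<le> m"
  shows "half_binomial (k + j) j \<le> half_binomial (m + j) j"
  unfolding half_binomial_add_eq_prod using assms by (intro prod_mono2) auto

lemma half_binomial_submult:
  "half_binomial (k + (i + j)) (i + j) \<le> half_binomial (k + i) i * half_binomial (k + j) j"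
  unfolding half_binomial_add_eq_prod prod.distrib[symmetric]
proof (intro prod_mono conjI)
  fix l
  have "1 + (x + y) \<le> (1 + x) * (1 + y)" if "x \<ge> 0" "y \<ge> 0" for x y :: real
    using mult_nonneg_nonneg[OF that] by (simp add: algebra_simps)
  from this[of "real i / (1/2 + real l)" "real j / (1/2 + real l)"]
  show "1 + real (i + j) / (1/2 + real l)
      \<le> (1 + real i / (1/2 + real l)) * (1 + real j / (1/2 + real l))"
    by (simp add: add_divide_distrib)
qed auto

context prob_space
begin

text \<open>A Pochhammer symbol replaces the usual factorials so that ratios of moments become
  ratios of Pochhammer symbols, up to powers of \<open>2 * \<sigma>\<^sup>2\<close>.\<close>

lemma normal_even_moment:
  assumes "0 < \<sigma>" and "distributed M lborel X (normal_density 0 \<sigma>)"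
  shows "integrable M (\<lambda>\<omega>. X \<omega> ^ (2 * k))"
    and "expectation (\<lambda>\<omega>. X \<omega> ^ (2 * k)) = (2 * \<sigma>\<^sup>2) ^ k * pochhammer (1/2) k"
proof -
  have moment: "has_bochner_integral lborel (\<lambda>x. normal_density 0 \<sigma> x * x ^ (2 * k))
      (fact (2 * k) / ((2 / \<sigma>\<^sup>2) ^ k * fact k))"
    using normal_moment_even[OF \<open>0 < \<sigma>\<close>, of 0 k] by simp
  show "integrable M (\<lambda>\<omega>. X \<omega> ^ (2 * k))"
    using distributed_integrable[OF assms(2), of "\<lambda>x. x ^ (2 * k)"] moment
    by (simp add: has_bochner_integral_iff)
  have "expectation (\<lambda>\<omega>. X \<omega> ^ (2 * k)) = fact (2 * k) / ((2 / \<sigma>\<^sup>2) ^ k * fact k)"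
    using distributed_integral[OF assms(2), of "\<lambda>x. x ^ (2 * k)"] moment
    by (simp add: has_bochner_integral_iff)
  also have "\<dots> = (2 * \<sigma>\<^sup>2) ^ k * pochhammer (1/2) k"
  proof -
    \<comment> \<open>By \<open>fact_double\<close>, \<open>fact (2 * k)\<close> equals
      \<open>2 ^ (2 * k) * pochhammer (1/2) k * fact k\<close>; one of the two factors
      \<open>2 ^ k\<close> cancels against the denominator.\<close>
    have "(2::real) ^ (2 * k) = 2 ^ k * 2 ^ k"
      by (simp add: mult_2 power_add)
    then show ?thesis
      using \<open>0 < \<sigma>\<close> by (simp add: fact_double power_divide power_mult_distrib)
  qed
  finally show "expectation (\<lambda>\<omega>. X \<omega> ^ (2 * k)) = (2 * \<sigma>\<^sup>2) ^ k * pochhammer (1/2) k" .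
qed

lemma normal_odd_moment:
  assumes "0 < \<sigma>" and "distributed M lborel X (normal_density 0 \<sigma>)" and "odd k"
  shows "integrable M (\<lambda>\<omega>. X \<omega> ^ k)"
    and "expectation (\<lambda>\<omega>. X \<omega> ^ k) = 0"
proof -
  obtain l where k: "k = 2 * l + 1"
    using \<open>odd k\<close> by (elim oddE)
  have moment: "has_bochner_integral lborel (\<lambda>x. normal_density 0 \<sigma> x * x ^ k) 0"
    using normal_moment_odd[OF \<open>0 < \<sigma>\<close>, of 0 l] by (simp add: k)
  show "integrable M (\<lambda>\<omega>. X \<omega> ^ k)"
    using distributed_integrable[OF assms(2), of "\<lambda>x. x ^ k"] moment
    by (simp add: has_bochner_integral_iff)
  show "expectation (\<lambda>\<omega>. X \<omega> ^ k) = 0"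
    using distributed_integral[OF assms(2), of "\<lambda>x. x ^ k"] moment
    by (simp add: has_bochner_integral_iff)
qed

lemma normal_moment_integrable:
  assumes "0 < \<sigma>" and "distributed M lborel X (normal_density 0 \<sigma>)"
  shows "integrable M (\<lambda>\<omega>. X \<omega> ^ k)"
  using normal_even_moment(1)[OF assms, of "k div 2"] normal_odd_moment(1)[OF assms, of k]
  by (cases "even k") auto

text \<open>The exponents of \<open>2 * \<sigma>\<^sup>2\<close> add up, so the variance cancels and
  only the ratio of Pochhammer symbols remains.\<close>

lemma normal_even_moment_add:
  assumes "0 < \<sigma>" and "distributed M lborel X (normal_density 0 \<sigma>)"
  shows "expectation (\<lambda>\<omega>. X \<omega> ^ (2 * m + 2 * j)) = half_binomial (m + j) j
    * expectation (\<lambda>\<omega>. X \<omega> ^ (2 * m)) * expectation (\<lambda>\<omega>. X \<omega> ^ (2 * j))"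
proof -
  have "pochhammer (1/2::real) l \<noteq> 0" for l
    using pochhammer_pos[of "1/2::real" l] by simp
  moreover have "expectation (\<lambda>\<omega>. X \<omega> ^ (2 * m + 2 * j))
      = (2 * \<sigma>\<^sup>2) ^ (m + j) * pochhammer (1/2) (m + j)"
    using normal_even_moment(2)[OF assms, of "m + j"] by (simp add: algebra_simps)
  ultimately show ?thesis
    by (simp add: normal_even_moment(2)[OF assms] half_binomial_def power_add)
qed

text \<open>The case \<open>p = q = 0\<close> expands the moments of the sum with the same binomial
  weights as the general case, so the two sides of the final inequality can be compared summand by
  summand.\<close>

lemma expectation_mult_indep_powers:
  fixes X Y :: "'a \<Rightarrow> real"
  assumes indep: "indep_var borel X borel Y"
    and int: "\<And>k. integrable M (\<lambda>\<omega>. X \<omega> ^ k)" "\<And>k. integrable M (\<lambda>\<omega>. Y \<omega> ^ k)"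
  shows "expectation (\<lambda>\<omega>. X \<omega> ^ p * Y \<omega> ^ q * (X \<omega> + Y \<omega>) ^ d) =
    (\<Sum>k\<le>d. real (d choose k) * (expectation (\<lambda>\<omega>. X \<omega> ^ (p + k))
      * expectation (\<lambda>\<omega>. Y \<omega> ^ (q + (d - k)))))"
proof -
  have indep': "indep_var borel (\<lambda>\<omega>. X \<omega> ^ i) borel (\<lambda>\<omega>. Y \<omega> ^ j)" for i j
    using indep_var_compose[OF indep, of "\<lambda>x. x ^ i" borel "\<lambda>x. x ^ j" borel]
    by (simp add: comp_def)
  have "X \<omega> ^ p * Y \<omega> ^ q * (X \<omega> + Y \<omega>) ^ d
      = (\<Sum>k\<le>d. real (d choose k) * (X \<omega> ^ (p + k) * Y \<omega> ^ (q + (d - k))))" for \<omega>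
    \<comment> \<open>Removing \<open>Nat.add_diff_assoc\<close> keeps the exponent as
      \<open>q + (d - k)\<close>, a sum that \<open>power_add\<close> can split.\<close>
    by (simp add: binomial_ring sum_distrib_left power_add mult_ac del: Nat.add_diff_assoc)
  then show ?thesis
    by (simp add: indep_var_lebesgue_integral[OF indep' int]
        indep_var_integrable[OF indep' int])
qed

end

theorem proposition2p1:
  fixes M :: "'a measure" and X Y :: "'a \<Rightarrow> real" and \<sigma> \<tau> :: real and m n r :: nat
  assumes "prob_space M"
    and "0 < \<sigma>" and "distributed M lborel X (normal_density 0 \<sigma>)"
    and "0 < \<tau>" and "distributed M lborel Y (normal_density 0 \<tau>)"
    and "prob_space.indep_var M borel X borel Y"
    and "1 \<le> m" and "1 \<le> n" and "1 \<le> r"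
  shows "prob_space.expectation M (\<lambda>\<omega>. X \<omega> ^ (2 * m) * Y \<omega> ^ (2 * n) * (X \<omega> + Y \<omega>) ^ (2 * r))
    \<ge> half_binomial (min m n + r) r
        * prob_space.expectation M (\<lambda>\<omega>. X \<omega> ^ (2 * m))
        * prob_space.expectation M (\<lambda>\<omega>. Y \<omega> ^ (2 * n))
        * prob_space.expectation M (\<lambda>\<omega>. (X \<omega> + Y \<omega>) ^ (2 * r))"
proof -
  interpret prob_space M by fact
  note X = \<open>0 < \<sigma>\<close> \<open>distributed M lborel X (normal_density 0 \<sigma>)\<close>
  note Y = \<open>0 < \<tau>\<close> \<open>distributed M lborel Y (normal_density 0 \<tau>)\<close>
  note expand = expectation_mult_indep_powers[OF
      \<open>indep_var borel X borel Y\<close> normal_moment_integrable[OF X] normal_moment_integrable[OF Y]]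
  define A where "A = (\<lambda>k. expectation (\<lambda>\<omega>. X \<omega> ^ k))"
  define B where "B = (\<lambda>k. expectation (\<lambda>\<omega>. Y \<omega> ^ k))"
  define H where "H = half_binomial (min m n + r) r"
  have A_nonneg: "A (2 * j) \<ge> 0" and B_nonneg: "B (2 * j) \<ge> 0" for j
    by (simp_all add: A_def B_def)
  have term_le: "H * A (2 * m) * B (2 * n) * (A k * B (2 * r - k))
      \<le> A (2 * m + k) * B (2 * n + (2 * r - k))" if "k \<le> 2 * r" for k
  proof (cases "even k")
    \<comment> \<open>Here \<open>k\<close> and \<open>2 * m + k\<close> are both odd, so the
      moments of \<open>X\<close> vanish on both sides.\<close>
    case False
    then show ?thesis
      using normal_odd_moment(2)[OF X, of k] normal_odd_moment(2)[OF X, of "2 * m + k"]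
      by (simp add: A_def)
  next
    case True
    then obtain i where k: "k = 2 * i" by blast
    define j where "j = r - i"
    have r: "r = i + j" and rk: "2 * r - k = 2 * j"
      using that by (auto simp: k j_def)
    \<comment> \<open>Submultiplicativity requires one common number of factors, here
      \<open>min m n\<close>; monotonicity then raises it to \<open>m\<close> and to
      \<open>n\<close> separately.\<close>
    have "H \<le> half_binomial (min m n + i) i * half_binomial (min m n + j) j"
      unfolding H_def r by (rule half_binomial_submult)
    also have "\<dots> \<le> half_binomial (m + i) i * half_binomial (n + j) j"
      by (intro mult_mono half_binomial_add_mono) (auto intro: less_imp_le half_binomial_add_pos)
    finally have "H * (A (2 * m) * B (2 * n) * (A (2 * i) * B (2 * j)))
      \<le> half_binomial (m + i) i * half_binomial (n + j) j
        * (A (2 * m) * B (2 * n) * (A (2 * i) * B (2 * j)))"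
      by (rule mult_right_mono) (intro mult_nonneg_nonneg A_nonneg B_nonneg)
    also have "\<dots> = A (2 * m + 2 * i) * B (2 * n + 2 * j)"
      unfolding A_def B_def normal_even_moment_add[OF X] normal_even_moment_add[OF Y] by simp
    finally show ?thesis
      unfolding rk by (simp add: k mult.assoc)
  qed
  have "H * A (2 * m) * B (2 * n) * expectation (\<lambda>\<omega>. (X \<omega> + Y \<omega>) ^ (2 * r))
      = (\<Sum>k\<le>2 * r. real (2 * r choose k) * (H * A (2 * m) * B (2 * n) * (A k * B (2 * r - k))))"
    using expand[of 0 0 "2 * r"] by (simp add: A_def B_def sum_distrib_left mult_ac)
  also have "\<dots> \<le> (\<Sum>k\<le>2 * r. real (2 * r choose k) * (A (2 * m + k) * B (2 * n + (2 * r - k))))"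
    by (intro sum_mono mult_left_mono term_le) auto
  also have "\<dots> = expectation (\<lambda>\<omega>. X \<omega> ^ (2 * m) * Y \<omega> ^ (2 * n) * (X \<omega> + Y \<omega>) ^ (2 * r))"
    unfolding expand A_def B_def ..
  finally show ?thesis
    unfolding A_def B_def H_def .
qed

end
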